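(* Let $P_1(x)=\|x\|_*$ on $\mathbb{R}^{m\times n}$, let $P_2$ be a norm on $\mathbb{R}^{m\times n}$ with $P_2\le\mu P_1$ for some $\mu\in[0,1)$, let $\sigma>0$, let $y\in\mathbb{R}^{m\times n}$ satisfy $P_1(y)-P_2(y)\le\sigma$, and let $\xi\in\partial P_2(y)$. Let $a\in\mathbb{R}^{m\times n}$ with $a\neq0$ and consider the problem $$\min_{x\in\mathbb{R}^{m\times n}}\ \langle a,x\rangle\quad\text{s.t.}\quad\|x\|_*-\langle\xi,x\rangle\le\sigma.\qquad(\ast)$$ Define the symmetric $(m+n)\times(m+n)$ matrices $$\widetilde A=\begin{bmatrix} 0 & a \\ {} a^T & 0 \end{bmatrix},\qquad\widetilde\Xi=\begin{bmatrix} 0 & \xi \\ {} \xi^T & 0 \end{bmatrix}.$$ Let $z\in\mathbb{R}^{m+n}$ be a generalized eigenvector of the smallest generalized eigenvalue of the matrix pencil $(\widetilde A,I-\widetilde\Xi)$, normalized so that $z^T(I-\widetilde\Xi)z=1$. Then $x^*=2\sigma z_1z_2^T$ is an optimal solution of $(\ast)$, where $z=\begin{bmatrix}z_1^T&z_2^T\end{bmatrix}^T$ with $z_1\in\mathbb{R}^m$ and $z_2\in\mathbb{R}^n$.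
   Context: $\|\cdot\|_*$ is the nuclear norm (sum of singular values), $\langle\cdot,\cdot\rangle$ is the trace inner product on $\mathbb{R}^{m\times n}$, and $\partial P_2$ is the subdifferential of convex analysis. A generalized eigenvector of the pencil $(\widetilde A,I-\widetilde\Xi)$ with generalized eigenvalue $\lambda$ is a nonzero $z$ with $\widetilde Az=\lambda(I-\widetilde\Xi)z$. *)

theory Defs
  imports "HOL-Analysis.Analysis"
begin

(* An m x n real matrix is an element of real ^ 'n ^ 'm.  The library inner product on this type
   is the trace inner product. *)
lemma inner_matrix_eq_trace:
  fixes A B :: "real ^ 'n ^ 'm"
  shows "A \<bullet> B = trace (transpose A ** B)"
proof -
  have "A \<bullet> B = (\<Sum>i\<in>UNIV. \<Sum>j\<in>UNIV. A $ i $ j * B $ i $ j)"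
    by (simp add: inner_vec_def)
  also have "\<dots> = (\<Sum>j\<in>UNIV. \<Sum>i\<in>UNIV. A $ i $ j * B $ i $ j)"
    by (rule sum.swap)
  also have "\<dots> = trace (transpose A ** B)"
    by (simp add: trace_def transpose_def matrix_matrix_mult_def)
  finally show ?thesis .
qed

(* A singular value s is a nonnegative square root of an
   eigenvalue of A\<^sup>T A, and its multiplicity is the dimension of that eigenspace.  When m < n
   this counts s = 0 more often than the min m n convention, which does not affect the sum. *)
definition right_singular_space :: "real ^ 'n ^ 'm \<Rightarrow> real \<Rightarrow> (real ^ 'n) set" where
  "right_singular_space A s = {v. (transpose A ** A) *v v = s\<^sup>2 *\<^sub>R v}"

definition singular_values :: "real ^ 'n ^ 'm \<Rightarrow> real set" where
  "singular_values A = {s. 0 \<le> s \<and> (\<exists>v. v \<noteq> 0 \<and> v \<in> right_singular_space A s)}"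

definition nuclear_norm :: "real ^ 'n ^ 'm \<Rightarrow> real" where
  "nuclear_norm A = (\<Sum>s\<in>singular_values A. real (dim (right_singular_space A s)) * s)"

(* The sum above is over a finite set, so it is never 0 by default. *)
lemma finite_singular_values: "finite (singular_values A)"
proof -
  let ?M = "transpose A ** A"
  have "\<forall>s\<in>singular_values A. \<exists>v. v \<noteq> 0 \<and> ?M *v v = s\<^sup>2 *\<^sub>R v"
    by (auto simp: singular_values_def right_singular_space_def)
  then obtain w where w: "\<And>s. s \<in> singular_values A \<Longrightarrow> w s \<noteq> 0"
    "\<And>s. s \<in> singular_values A \<Longrightarrow> ?M *v w s = s\<^sup>2 *\<^sub>R w s"
    by metis
  have sym: "(?M *v u) \<bullet> v = u \<bullet> (?M *v v)" for u v
    by (metis dot_lmul_matrix inner_commute matrix_transpose_mul transpose_transpose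
        vector_transpose_matrix)
  have orth: "w s \<bullet> w t = 0"
    if "s \<in> singular_values A" "t \<in> singular_values A" "s \<noteq> t" for s t
  proof -
    have "s\<^sup>2 * (w s \<bullet> w t) = t\<^sup>2 * (w s \<bullet> w t)"
      using sym[of "w s" "w t"] w(2)[OF that(1)] w(2)[OF that(2)] by simp
    moreover have "s\<^sup>2 \<noteq> t\<^sup>2"
      using that by (auto simp: singular_values_def)
    ultimately show ?thesis by simp
  qed
  have inj: "inj_on w (singular_values A)"
  proof (rule inj_onI, rule ccontr)
    fix s t
    assume st: "s \<in> singular_values A" "t \<in> singular_values A" "w s = w t" "s \<noteq> t"
    then have "w s \<bullet> w s = 0" using orth by metis
    then show False using w(1) st(1) by simp
  qed
  have "independent (w ` singular_values A)"
  proof (rule pairwise_orthogonal_independent)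
    show "pairwise orthogonal (w ` singular_values A)"
      unfolding pairwise_def orthogonal_def using orth by blast
    show "0 \<notin> w ` singular_values A" using w(1) by force
  qed
  then show ?thesis
    using inj finite_imageD independent_imp_finite by blast
qed

definition is_norm :: "('a::real_vector \<Rightarrow> real) \<Rightarrow> bool" where
  "is_norm p \<longleftrightarrow>
     (\<forall>x. 0 \<le> p x) \<and>
     (\<forall>x. p x = 0 \<longleftrightarrow> x = 0) \<and>
     (\<forall>c x. p (c *\<^sub>R x) = \<bar>c\<bar> * p x) \<and>
     (\<forall>x y. p (x + y) \<le> p x + p y)"

definition subdifferential :: "('a::real_inner \<Rightarrow> real) \<Rightarrow> 'a \<Rightarrow> 'a set" where
  "subdifferential f y = {\<xi>. \<forall>x. f y + \<xi> \<bullet> (x - y) \<le> f x}"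

(* The symmetric block matrix [[0, B], [B\<^sup>T, 0]]; the index set {1..m+n} is the sum type. *)
definition sym_block :: "real ^ 'n ^ 'm \<Rightarrow> real ^ ('m + 'n) ^ ('m + 'n)" where
  "sym_block B = (\<chi> p q. case (p, q) of
       (Inl i, Inr j) \<Rightarrow> B $ i $ j
     | (Inr j, Inl i) \<Rightarrow> transpose B $ j $ i
     | _ \<Rightarrow> 0)"

definition upper_part :: "real ^ ('m::finite + 'n::finite) \<Rightarrow> real ^ 'm" where
  "upper_part z = (\<chi> i. z $ Inl i)"

definition lower_part :: "real ^ ('m::finite + 'n::finite) \<Rightarrow> real ^ 'n" where
  "lower_part z = (\<chi> j. z $ Inr j)"

definition outer_prod :: "real ^ 'm \<Rightarrow> real ^ 'n \<Rightarrow> real ^ 'n ^ 'm" where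
  "outer_prod u v = (columnvector u :: real ^ 1 ^ 'm) ** (rowvector v :: real ^ 'n ^ 1)"

lemma outer_prod_nth [simp]: "outer_prod u v $ i $ j = u $ i * v $ j"
  by (simp add: outer_prod_def matrix_matrix_mult_def columnvector_def rowvector_def)

definition generalized_eigenvector ::
    "real ^ 'k ^ 'k \<Rightarrow> real ^ 'k ^ 'k \<Rightarrow> real \<Rightarrow> real ^ 'k \<Rightarrow> bool" where
  "generalized_eigenvector A B l z \<longleftrightarrow> z \<noteq> 0 \<and> A *v z = l *\<^sub>R (B *v z)"

definition generalized_eigenvalue :: "real ^ 'k ^ 'k \<Rightarrow> real ^ 'k ^ 'k \<Rightarrow> real \<Rightarrow> bool" where
  "generalized_eigenvalue A B l \<longleftrightarrow> (\<exists>z. generalized_eigenvector A B l z)"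

definition smallest_generalized_eigenvalue ::
    "real ^ 'k ^ 'k \<Rightarrow> real ^ 'k ^ 'k \<Rightarrow> real \<Rightarrow> bool" where
  "smallest_generalized_eigenvalue A B l \<longleftrightarrow>
     generalized_eigenvalue A B l \<and> (\<forall>l'. generalized_eigenvalue A B l' \<longrightarrow> l \<le> l')"

end

theory Submission
  imports Defs
begin

text \<open>
  The problem reduces to its rank-one feasible points, where it becomes a Rayleigh quotient problem.
  Write \<open>B = mat 1 - sym_block \<xi>\<close>. For a vector \<open>w\<close> with blocks \<open>u\<close> and \<open>v\<close>, the two quadratic
  forms of the pencil are \<open>2 * (u \<bullet> (a *v v))\<close> and \<open>|u|\<^sup>2 + |v|\<^sup>2 - 2 * (u \<bullet> (\<xi> *v v))\<close>. If
  \<open>|u| = |v|\<close>, these are twice the objective and twice the constraint function at \<open>outer_prod u v\<close>.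

  A subgradient of \<open>P2\<close> satisfies \<open>\<xi> \<bullet> w \<le> P2 w\<close> everywhere, hence \<open>\<xi> \<bullet> w \<le> \<mu> * nuclear_norm w\<close>.
  On rank-one matrices this says that \<open>B\<close> is positive definite, because \<open>\<mu> < 1\<close>. The smallest
  generalized eigenvalue \<open>l\<close> is therefore the minimum of the Rayleigh quotient
  (lemma \<open>smallest_generalized_eigenvalue_rayleigh\<close>), and \<open>l \<le> 0\<close>, since the form of
  \<open>sym_block a\<close> vanishes on vectors whose second block is zero.

  The Rayleigh bound on unit vectors \<open>u\<close>, \<open>v\<close> reads \<open>u \<bullet> ((a + l *\<^sub>R \<xi>) *v v) \<ge> l\<close>. By the duality of
  the nuclear and the spectral norm (lemma \<open>inner_le_nuclear_norm\<close>) it extends to all matrices: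
  \<open>(a + l *\<^sub>R \<xi>) \<bullet> x \<ge> l * nuclear_norm x\<close>. So \<open>a \<bullet> x \<ge> l * (nuclear_norm x - \<xi> \<bullet> x) \<ge> l * \<sigma>\<close> for
  every feasible \<open>x\<close>; the last step is where \<open>l \<le> 0\<close> enters.

  The value \<open>l * \<sigma>\<close> is attained: the form of \<open>sym_block a\<close> at the normalized eigenvector \<open>z\<close> equals
  \<open>l\<close>, which is the objective at the candidate divided by \<open>\<sigma>\<close>. The candidate is feasible because
  \<open>nuclear_norm (outer_prod u v) \<le> |u| * |v| \<le> (|u|\<^sup>2 + |v|\<^sup>2) / 2\<close>, which turns the normalization of
  \<open>z\<close> into the constraint.
\<close>

section \<open>Minimal eigenvectors of a symmetric-definite pencil\<close>

text \<open>
  The Rayleigh quotient attains its minimum \<open>r\<close> on the compact unit sphere of \<open>S\<close>. At a minimizer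
  \<open>v\<close> the positive semidefinite form of \<open>C = A - r B\<close> vanishes, and a semidefinite form that
  vanishes at \<open>v\<close> has \<open>v\<close> in its kernel: otherwise a small step from \<open>v\<close> in direction \<open>- C v\<close> would
  make it negative. Invariance of \<open>S\<close> keeps that step inside \<open>S\<close>. The lemma serves twice:
  with \<open>S = UNIV\<close> for the pencil of the theorem, and with \<open>B\<close> the identity and \<open>S\<close> an orthogonal
  complement for the spectral theorem behind the singular value decomposition.
\<close>
lemma pencil_minimal_eigenvector:
  fixes A B :: "'a::euclidean_space \<Rightarrow> 'a"
  assumes A: "linear A" "\<And>u v. A u \<bullet> v = u \<bullet> A v" "\<And>u. u \<in> S \<Longrightarrow> A u \<in> S"
    and B: "linear B" "\<And>u v. B u \<bullet> v = u \<bullet> B v" "\<And>u. u \<in> S \<Longrightarrow> B u \<in> S"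
    and pos: "\<And>u. u \<in> S \<Longrightarrow> u \<noteq> 0 \<Longrightarrow> 0 < u \<bullet> B u"
    and S: "subspace S" "S \<noteq> {0}"
  obtains r v where "v \<in> S" "v \<noteq> 0" "A v = r *\<^sub>R B v"
    "\<And>u. u \<in> S \<Longrightarrow> r * (u \<bullet> B u) \<le> u \<bullet> A u"
proof -
  let ?U = "S \<inter> sphere 0 1"
  let ?R = "\<lambda>u. (u \<bullet> A u) / (u \<bullet> B u)"
  have "compact ?U"
    using S(1) by (simp add: closed_Int_compact closed_subspace)
  moreover obtain u0 where u0: "u0 \<in> S" "u0 \<noteq> 0"
    using S subspace_0 by blast
  then have "u0 /\<^sub>R norm u0 \<in> ?U"
    using S(1) by (simp add: subspace_scale)
  then have "?U \<noteq> {}" by blast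
  moreover have "continuous_on ?U ?R"
  proof (intro continuous_intros linear_continuous_on)
    show "bounded_linear A" "bounded_linear B"
      using A(1) B(1) by (simp_all add: linear_conv_bounded_linear)
    show "\<forall>u\<in>?U. u \<bullet> B u \<noteq> 0"
      using pos by fastforce
  qed
  ultimately obtain v where v: "v \<in> ?U" "\<And>u. u \<in> ?U \<Longrightarrow> ?R v \<le> ?R u"
    using continuous_attains_inf[of ?U ?R] by blast
  define r where "r = ?R v"
  have v0: "v \<in> S" "v \<noteq> 0"
    using v(1) by auto
  have lower: "r * (u \<bullet> B u) \<le> u \<bullet> A u" if u: "u \<in> S" for u
  proof (cases "u = 0")
    case False
    let ?u = "u /\<^sub>R norm u"
    have "?u \<in> ?U"
      using u False S(1) by (simp add: subspace_scale)
    then have "r \<le> ?R ?u"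
      unfolding r_def by (rule v(2))
    also have "?R ?u = ?R u"
      using False by (simp add: linear_scale[OF A(1)] linear_scale[OF B(1)])
    finally show ?thesis
      using pos[OF u False] by (simp add: pos_le_divide_eq)
  qed simp
  define C where "C u = A u - r *\<^sub>R B u" for u
  have linC: "C (u + t *\<^sub>R w) = C u + t *\<^sub>R C w" for u w t
    by (simp add: C_def linear_add[OF A(1)] linear_add[OF B(1)] linear_scale[OF A(1)]
        linear_scale[OF B(1)] algebra_simps)
  have symC: "C u \<bullet> w = u \<bullet> C w" for u w
    by (simp add: C_def inner_diff_left inner_diff_right A(2) B(2))
  have psd: "0 \<le> u \<bullet> C u" if "u \<in> S" for u
    using lower[OF that] by (simp add: C_def inner_diff_right)
  have vCv: "v \<bullet> C v = 0"
    using pos[OF v0] by (simp add: C_def inner_diff_right r_def)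
  have CvS: "C v \<in> S"
    using v0(1) A(3) B(3) S(1) by (simp add: C_def subspace_diff subspace_scale)
  let ?n = "C v \<bullet> C v" and ?q = "C v \<bullet> C (C v)"
  have par: "0 \<le> 2 * t * ?n + t\<^sup>2 * ?q" for t
  proof -
    have "0 \<le> (v + t *\<^sub>R C v) \<bullet> C (v + t *\<^sub>R C v)"
      using v0(1) CvS S(1) by (intro psd) (simp add: subspace_add subspace_scale)
    also have "\<dots> = 2 * t * ?n + t\<^sup>2 * ?q"
      by (simp add: linC inner_add_left inner_add_right vCv symC[of v "C v", symmetric]
          power2_eq_square algebra_simps)
    finally show ?thesis .
  qed
  have "?n = 0"
  proof (rule ccontr)
    assume "?n \<noteq> 0"
    then have n: "0 < ?n" by simp
    have q: "0 \<le> ?q" using psd[OF CvS] .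
    (* The vertex of the parabola is at - ?n / ?q; the denominator is shifted by one so that it
       cannot vanish. *)
    define t where "t = ?n / (?q + 1)"
    have nt: "?n = t * (?q + 1)"
      using q by (simp add: t_def)
    have "0 \<le> 2 * (- t) * ?n + (- t)\<^sup>2 * ?q"
      by (rule par)
    also have "\<dots> = - (t\<^sup>2 * (?q + 2))"
      unfolding nt by (simp add: power2_eq_square algebra_simps)
    also have "\<dots> < 0"
      using n q by (simp add: t_def)
    finally show False by simp
  qed
  then have "A v = r *\<^sub>R B v"
    by (simp add: C_def)
  then show thesis
    using that v0 lower by blast
qed

section \<open>The nuclear norm and its duality with the trace inner product\<close>

lemma gram_matrix_inner:
  fixes x :: "real ^ 'n ^ 'm"
  shows "((transpose x ** x) *v u) \<bullet> v = (x *v u) \<bullet> (x *v v)"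
  by (metis dot_lmul_matrix matrix_vector_mul_assoc transpose_matrix_vector)

lemma subspace_right_singular_space: "subspace (right_singular_space x s)"
  unfolding right_singular_space_def subspace_def
  by (simp add: matrix_vector_right_distrib matrix_vector_mult_scaleR scaleR_add_right)

lemma norm_mult_right_singular_vector:
  assumes "v \<in> right_singular_space x s" "0 \<le> s"
  shows "norm (x *v v) = s * norm v"
proof -
  have "(norm (x *v v))\<^sup>2 = (s * norm v)\<^sup>2"
    using gram_matrix_inner[of x v v] assms(1)
    by (simp add: right_singular_space_def power_mult_distrib dot_square_norm)
  then show ?thesis
    using assms(2) by (simp add: power2_eq_iff_nonneg)
qed

lemma right_singular_spaces_orthogonal:
  assumes "u \<in> right_singular_space x s" "v \<in> right_singular_space x t"
    and "0 \<le> s" "0 \<le> t" "s \<noteq> t"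
  shows "u \<bullet> v = 0"
proof -
  have "s\<^sup>2 * (u \<bullet> v) = t\<^sup>2 * (u \<bullet> v)"
    using gram_matrix_inner[of x u v] gram_matrix_inner[of x v u] assms(1,2)
    by (simp add: right_singular_space_def inner_commute)
  then show ?thesis
    using assms(3-5) by simp
qed

text \<open>
  This is the spectral theorem for \<open>transpose x ** x\<close>. Otherwise the orthogonal complement of the
  eigenspaces would be a nonzero invariant subspace, so it would contain an eigenvector; its
  eigenvalue is nonnegative, hence the square of a singular value, and the eigenvector would be
  orthogonal to itself.
\<close>
lemma span_right_singular_vectors:
  fixes x :: "real ^ 'n ^ 'm"
  shows "span (\<Union>s\<in>singular_values x. right_singular_space x s) = UNIV" (is "span ?W = UNIV")
proof (rule ccontr)
  assume neq: "span ?W \<noteq> UNIV"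
  let ?M = "\<lambda>v. (transpose x ** x) *v v"
  define S where "S = {u. \<forall>w\<in>?W. u \<bullet> w = 0}"
  have subS: "subspace S"
    by (auto simp: S_def subspace_def inner_add_left)
  obtain d where d: "d \<noteq> 0" "\<And>w. w \<in> span ?W \<Longrightarrow> orthogonal d w"
    using orthogonal_to_subspace_exists_gen[of ?W UNIV] neq
    by (auto simp: span_UNIV orthogonal_def)
  have "d \<in> S"
    using d(2)[OF span_base] unfolding S_def orthogonal_def by blast
  have selfadj: "?M u \<bullet> v = u \<bullet> ?M v" for u v
    using gram_matrix_inner[of x u v] gram_matrix_inner[of x v u] by (simp add: inner_commute)
  have inv: "?M u \<in> S" if "u \<in> S" for u
    using that by (auto simp: S_def selfadj right_singular_space_def)
  obtain r v where v: "v \<in> S" "v \<noteq> 0" "?M v = r *\<^sub>R v"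
    by (rule pencil_minimal_eigenvector[of ?M S "\<lambda>v. v"])
      (use selfadj inv subS \<open>d \<in> S\<close> d(1) in \<open>auto intro: linear_id[unfolded id_def]\<close>)
  have "r * (v \<bullet> v) = (x *v v) \<bullet> (x *v v)"
    using gram_matrix_inner[of x v v] v(3) by simp
  then have "0 \<le> r"
    using v(2) by (metis inner_ge_zero inner_gt_zero_iff zero_le_mult_iff not_le)
  then have "v \<in> right_singular_space x (sqrt r)"
    using v(3) by (simp add: right_singular_space_def)
  then have "v \<in> ?W"
    using v(2) \<open>0 \<le> r\<close> real_sqrt_ge_zero unfolding singular_values_def by blast
  then have "v \<bullet> v = 0"
    using v(1) unfolding S_def by blast
  then show False
    using v(2) by simp
qed

text \<open>
  Concatenating orthonormal bases of the eigenspaces gives right singular vectors of \<open>x\<close>, and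
  \<open>norm (x *v b)\<close> is the singular value that belongs to \<open>b\<close>. The normalized nonzero vectors
  \<open>x *v b\<close> are the left singular vectors, so the basis carries a singular value decomposition of \<open>x\<close>.
\<close>
lemma nuclear_norm_orthonormal_basis:
  fixes x :: "real ^ 'n ^ 'm"
  obtains B where "finite B" "pairwise orthogonal B" "\<And>b. b \<in> B \<Longrightarrow> norm b = 1" "span B = UNIV"
    "nuclear_norm x = (\<Sum>b\<in>B. norm (x *v b))"
proof -
  let ?V = "singular_values x" and ?E = "right_singular_space x"
  have "\<exists>B. B \<subseteq> ?E s \<and> pairwise orthogonal B \<and> (\<forall>b\<in>B. norm b = 1) \<and> independent B
      \<and> card B = dim (?E s) \<and> span B = ?E s" for s
    using orthonormal_basis_subspace[OF subspace_right_singular_space[of x s]] by metis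
  then obtain F where F: "\<And>s. F s \<subseteq> ?E s" "\<And>s. pairwise orthogonal (F s)"
      "\<And>s b. b \<in> F s \<Longrightarrow> norm b = 1" "\<And>s. independent (F s)"
      "\<And>s. card (F s) = dim (?E s)" "\<And>s. span (F s) = ?E s"
    by metis
  have finF: "finite (F s)" for s
    using F(4) independent_imp_finite by blast
  have nonneg: "0 \<le> s" if "s \<in> ?V" for s
    using that by (simp add: singular_values_def)
  have orth: "b \<bullet> c = 0" if "s \<in> ?V" "t \<in> ?V" "s \<noteq> t" "b \<in> F s" "c \<in> F t" for s t b c
    using right_singular_spaces_orthogonal[of b x s c t] nonneg that F(1) by blast
  let ?B = "\<Union>s\<in>?V. F s"
  have disj: "F s \<inter> F t = {}" if "s \<in> ?V" "t \<in> ?V" "s \<noteq> t" for s t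
    using orth[OF that] F(3) by (metis disjoint_iff inner_eq_zero_iff norm_zero zero_neq_one)
  show thesis
  proof
    show "finite ?B"
      using finite_singular_values finF by blast
    show "pairwise orthogonal ?B"
      using F(2) orth unfolding pairwise_def orthogonal_def by (metis UN_iff)
    show "norm b = 1" if "b \<in> ?B" for b
      using that F(3) by blast
    have "(\<Union>s\<in>?V. ?E s) \<subseteq> span ?B"
      using F(6) span_mono[of _ ?B] by (metis UN_least UN_upper)
    then show "span ?B = UNIV"
      using span_right_singular_vectors[of x] span_minimal[OF _ subspace_span] by blast
    have "(\<Sum>b\<in>?B. norm (x *v b)) = (\<Sum>s\<in>?V. \<Sum>b\<in>F s. norm (x *v b))"
      using finite_singular_values finF disj by (intro sum.UNION_disjoint) auto
    also have "\<dots> = (\<Sum>s\<in>?V. real (dim (?E s)) * s)"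
    proof (rule sum.cong[OF refl])
      fix s assume s: "s \<in> ?V"
      have "norm (x *v b) = s" if "b \<in> F s" for b
        using norm_mult_right_singular_vector[of b x s] nonneg[OF s] F(1) F(3) that by fastforce
      then show "(\<Sum>b\<in>F s. norm (x *v b)) = real (dim (?E s)) * s"
        by (simp add: F(5))
    qed
    finally show "nuclear_norm x = (\<Sum>b\<in>?B. norm (x *v b))"
      by (simp add: nuclear_norm_def)
  qed
qed

text \<open>
  The trace inner product is the Hilbert-Schmidt inner product, which may be computed in any
  orthonormal basis: apply Parseval's identity to each pair of rows.
\<close>
lemma inner_matrix_orthonormal_basis:
  fixes c x :: "real ^ 'n ^ 'm"
  assumes "finite B" "pairwise orthogonal B" "\<And>b. b \<in> B \<Longrightarrow> norm b = 1" "span B = UNIV"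
  shows "c \<bullet> x = (\<Sum>b\<in>B. (c *v b) \<bullet> (x *v b))"
proof -
  have parseval: "u \<bullet> w = (\<Sum>b\<in>B. (u \<bullet> b) * (w \<bullet> b))" for u w :: "real ^ 'n"
  proof -
    have "u \<bullet> w = u \<bullet> (\<Sum>b\<in>B. (w \<bullet> b) *\<^sub>R b)"
      using orthonormal_basis_expand[OF assms(2,3) _ assms(1), of w] assms(4) by simp
    then show ?thesis
      by (simp add: inner_sum_right mult.commute)
  qed
  have "c \<bullet> x = (\<Sum>i\<in>UNIV. \<Sum>b\<in>B. (c $ i \<bullet> b) * (x $ i \<bullet> b))"
    by (simp add: inner_vec_def[of c x] parseval[symmetric])
  also have "\<dots> = (\<Sum>b\<in>B. \<Sum>i\<in>UNIV. (c $ i \<bullet> b) * (x $ i \<bullet> b))"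
    by (rule sum.swap)
  also have "\<dots> = (\<Sum>b\<in>B. (c *v b) \<bullet> (x *v b))"
    by (simp add: inner_vec_def[of "c *v _" "x *v _"] matrix_vector_mul_component)
  finally show ?thesis .
qed

text \<open>
  This is one half of the duality between nuclear norm and spectral norm. In a basis of right
  singular vectors of \<open>x\<close>, each term \<open>(c *v b) \<bullet> (x *v b)\<close> is bounded by \<open>K\<close> times a singular value.
\<close>
lemma inner_le_nuclear_norm:
  fixes c x :: "real ^ 'n ^ 'm"
  assumes "\<And>u v. norm u = 1 \<Longrightarrow> norm v = 1 \<Longrightarrow> u \<bullet> (c *v v) \<le> K"
  shows "c \<bullet> x \<le> K * nuclear_norm x"
proof -
  obtain B where B: "finite B" "pairwise orthogonal B" "\<And>b. b \<in> B \<Longrightarrow> norm b = 1"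
      "span B = UNIV" "nuclear_norm x = (\<Sum>b\<in>B. norm (x *v b))"
    using nuclear_norm_orthonormal_basis by blast
  have "(c *v b) \<bullet> (x *v b) \<le> K * norm (x *v b)" if b: "b \<in> B" for b
  proof (cases "x *v b = 0")
    case False
    then have "(x *v b /\<^sub>R norm (x *v b)) \<bullet> (c *v b) \<le> K"
      using B(3)[OF b] by (intro assms) auto
    then show ?thesis
      using False by (simp add: field_simps inner_commute)
  qed simp
  then show ?thesis
    by (simp add: inner_matrix_orthonormal_basis[OF B(1-4)] B(5) sum_distrib_left sum_mono)
qed

lemma inner_outer_prod:
  fixes c :: "real ^ 'n ^ 'm"
  shows "c \<bullet> outer_prod u v = u \<bullet> (c *v v)"
  by (simp add: inner_vec_def matrix_vector_mult_def sum_distrib_left mult_ac)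

text \<open>
  The Gram matrix of \<open>outer_prod u v\<close> maps \<open>w\<close> to \<open>(norm u)\<^sup>2 * (v \<bullet> w)\<close> times \<open>v\<close>. So the only
  possible nonzero singular value is \<open>norm u * norm v\<close>, and its eigenspace is contained in the line through \<open>v\<close>.
\<close>
lemma nuclear_norm_outer_prod_le:
  fixes u :: "real ^ 'm" and v :: "real ^ 'n"
  shows "nuclear_norm (outer_prod u v) \<le> norm u * norm v"
proof -
  let ?x = "outer_prod u v" and ?s = "norm u * norm v"
  have xw: "?x *v w = (v \<bullet> w) *\<^sub>R u" for w
    by (simp add: vec_eq_iff matrix_vector_mult_def inner_vec_def sum_distrib_left mult_ac)
  have Mw: "(transpose ?x ** ?x) *v w = ((norm u)\<^sup>2 * (v \<bullet> w)) *\<^sub>R v" for w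
  proof (rule vector_eq_rdot[THEN iffD1], rule allI)
    fix p
    show "((transpose ?x ** ?x) *v w) \<bullet> p = (((norm u)\<^sup>2 * (v \<bullet> w)) *\<^sub>R v) \<bullet> p"
      unfolding gram_matrix_inner by (simp add: xw dot_square_norm)
  qed
  have line: "w \<in> span {v}" if "w \<in> right_singular_space ?x s" "0 < s" for w s
  proof -
    have eq: "s\<^sup>2 *\<^sub>R w = ((norm u)\<^sup>2 * (v \<bullet> w)) *\<^sub>R v"
      using that(1) Mw by (simp add: right_singular_space_def)
    have "w = inverse (s\<^sup>2) *\<^sub>R (s\<^sup>2 *\<^sub>R w)"
      using that(2) by simp
    also have "\<dots> = (inverse (s\<^sup>2) * ((norm u)\<^sup>2 * (v \<bullet> w))) *\<^sub>R v"
      unfolding eq by simp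
    finally show ?thesis
      by (metis span_base span_scale singletonI)
  qed
  have val: "s = ?s" if s: "s \<in> singular_values ?x" "s \<noteq> 0" for s
  proof -
    obtain w where w: "w \<noteq> 0" "w \<in> right_singular_space ?x s" "0 \<le> s"
      using s(1) by (auto simp: singular_values_def)
    then obtain k where k: "w = k *\<^sub>R v"
      using line[of w s] s(2) by (auto simp: span_singleton)
    have "s * norm w = \<bar>v \<bullet> w\<bar> * norm u"
      using norm_mult_right_singular_vector[OF w(2,3)] by (simp add: xw)
    also have "\<dots> = ?s * norm w"
      by (simp add: k abs_mult power2_norm_eq_inner[symmetric] power2_eq_square)
    finally show ?thesis
      using w(1) by simp
  qed
  have "nuclear_norm ?x
      = (\<Sum>s\<in>singular_values ?x - {0}. real (dim (right_singular_space ?x s)) * s)"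
    unfolding nuclear_norm_def
    by (rule sum.mono_neutral_right) (use finite_singular_values in auto)
  also have "\<dots> \<le> (\<Sum>s\<in>{?s}. real (dim (right_singular_space ?x s)) * s)"
    by (rule sum_mono2) (use val in auto)
  also have "\<dots> \<le> ?s"
  proof (cases "?s = 0")
    case False
    then have "right_singular_space ?x ?s \<subseteq> span {v}"
      using line by (metis less_eq_real_def mult_nonneg_nonneg norm_ge_zero subsetI)
    then have "dim (right_singular_space ?x ?s) \<le> card {v}"
      by (intro dim_le_card) auto
    then have "real (dim (right_singular_space ?x ?s)) \<le> 1"
      by simp
    then show ?thesis
      using mult_right_mono[of _ 1 ?s] by simp
  next
    case True
    show ?thesis
      unfolding True by simp
  qed
  finally show ?thesis .
qed

section \<open>Subgradients of norms\<close>

text \<open>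
  Subgradients of a norm lie in the dual unit ball: step from \<open>y\<close> to \<open>y + w\<close> and use the triangle
  inequality.
\<close>
lemma subgradient_inner_le_norm:
  assumes "is_norm P" "\<xi> \<in> subdifferential P y"
  shows "\<xi> \<bullet> w \<le> P w"
proof -
  have "P y + \<xi> \<bullet> ((y + w) - y) \<le> P (y + w)"
    using assms(2) unfolding subdifferential_def by blast
  also have "\<dots> \<le> P y + P w"
    using assms(1) by (simp add: is_norm_def)
  finally show ?thesis by simp
qed

section \<open>Symmetric block matrices\<close>

lemma inner_upper_lower:
  fixes p q :: "real ^ ('m::finite + 'n::finite)"
  shows "p \<bullet> q = upper_part p \<bullet> upper_part q + lower_part p \<bullet> lower_part q"
  by (simp add: inner_vec_def upper_part_def lower_part_def UNIV_Plus_UNIV[symmetric] sum.Plus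
      del: UNIV_Plus_UNIV)

lemma norm_upper_lower: "(norm w)\<^sup>2 = (norm (upper_part w))\<^sup>2 + (norm (lower_part w))\<^sup>2"
  by (simp add: power2_norm_eq_inner inner_upper_lower[of w w])

lemma upper_part_sym_block: "upper_part (sym_block B *v w) = B *v lower_part w"
  by (simp add: vec_eq_iff upper_part_def lower_part_def sym_block_def matrix_vector_mult_def
      UNIV_Plus_UNIV[symmetric] sum.Plus del: UNIV_Plus_UNIV)

lemma lower_part_sym_block: "lower_part (sym_block B *v w) = transpose B *v upper_part w"
  by (simp add: vec_eq_iff upper_part_def lower_part_def sym_block_def matrix_vector_mult_def
      UNIV_Plus_UNIV[symmetric] sum.Plus del: UNIV_Plus_UNIV)

lemma inner_sym_block:
  "p \<bullet> (sym_block B *v q) =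
     upper_part p \<bullet> (B *v lower_part q) + upper_part q \<bullet> (B *v lower_part p)"
  by (simp add: inner_upper_lower[of p] upper_part_sym_block lower_part_sym_block)
    (metis dot_lmul_matrix inner_commute transpose_matrix_vector)

lemma quadratic_form_mat_1_minus_sym_block:
  "w \<bullet> ((mat 1 - sym_block B) *v w) =
     (norm (upper_part w))\<^sup>2 + (norm (lower_part w))\<^sup>2 - 2 * (upper_part w \<bullet> (B *v lower_part w))"
  by (simp add: matrix_vector_mult_diff_rdistrib inner_diff_right inner_sym_block
      dot_square_norm norm_upper_lower)

lemma obtain_parts:
  fixes u :: "real ^ 'm" and v :: "real ^ 'n"
  obtains w :: "real ^ ('m + 'n)" where "upper_part w = u" "lower_part w = v"
proof
  let ?w = "\<chi> p. case p of Inl i \<Rightarrow> u $ i | Inr j \<Rightarrow> v $ j"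
  show "upper_part ?w = u" "lower_part ?w = v"
    by (simp_all add: upper_part_def lower_part_def)
qed

text \<open>
  The hypothesis bounds the spectral norm of \<open>\<xi>\<close> by \<open>\<mu> < 1\<close>, so the cross term of the quadratic
  form is dominated by the squares of the two block norms.
\<close>
lemma positive_definite_mat_1_minus_sym_block:
  fixes \<xi> :: "real ^ 'n ^ 'm"
  assumes "\<And>u v. u \<bullet> (\<xi> *v v) \<le> \<mu> * (norm u * norm v)" "\<mu> < 1"
    and "w \<noteq> 0"
  shows "0 < w \<bullet> ((mat 1 - sym_block \<xi>) *v w)"
proof -
  let ?u = "norm (upper_part w)" and ?v = "norm (lower_part w)"
  have "?u\<^sup>2 + ?v\<^sup>2 = w \<bullet> w"
    by (simp add: norm_upper_lower dot_square_norm)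
  then have pos: "0 < ?u\<^sup>2 + ?v\<^sup>2"
    using assms(3) by simp
  have "2 * (upper_part w \<bullet> (\<xi> *v lower_part w)) \<le> 2 * (\<mu> * (?u * ?v))"
    using assms(1) by simp
  also have "\<dots> < ?u\<^sup>2 + ?v\<^sup>2"
  proof (cases "?u * ?v = 0")
    case False
    then have "0 < ?u * ?v"
      by (simp add: less_le)
    then have "\<mu> * (?u * ?v) < ?u * ?v"
      using mult_strict_right_mono[OF assms(2), of "?u * ?v"] by simp
    then show ?thesis
      using sum_squares_bound[of ?u ?v] by simp
  next
    case True
    show ?thesis
      unfolding True using pos by simp
  qed
  finally show ?thesis
    by (simp add: quadratic_form_mat_1_minus_sym_block)
qed

section \<open>Optimality of the rank-one matrix\<close>

text \<open>
  The minimum of the Rayleigh quotient is itself a generalized eigenvalue, so \<open>l\<close> is at most this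
  minimum.
\<close>
lemma smallest_generalized_eigenvalue_rayleigh:
  assumes "smallest_generalized_eigenvalue A B l"
    and "transpose A = A" "transpose B = B"
    and pos: "\<And>w. w \<noteq> 0 \<Longrightarrow> 0 < w \<bullet> (B *v w)"
  shows "l * (w \<bullet> (B *v w)) \<le> w \<bullet> (A *v w)"
proof -
  have selfadj: "(M *v u) \<bullet> v = u \<bullet> (M *v v)" if "transpose M = M" for M :: "real ^ 'k ^ 'k" and u v
    using that by (metis dot_lmul_matrix transpose_matrix_vector)
  have ex: "\<exists>b :: real ^ 'k. b \<noteq> 0"
    using vector_one_nth by (metis zero_neq_one zero_index one_index)
  obtain r v where r: "v \<noteq> 0" "A *v v = r *\<^sub>R (B *v v)"
      "\<And>u. r * (u \<bullet> (B *v u)) \<le> u \<bullet> (A *v u)"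
    by (rule pencil_minimal_eigenvector[of "(*v) A" UNIV "(*v) B"])
      (use selfadj assms(2,3) pos ex in auto)
  then have "l \<le> r"
    using assms(1) unfolding smallest_generalized_eigenvalue_def generalized_eigenvalue_def
      generalized_eigenvector_def by blast
  moreover have "0 \<le> w \<bullet> (B *v w)"
    using pos[of w] by (cases "w = 0") auto
  ultimately have "l * (w \<bullet> (B *v w)) \<le> r * (w \<bullet> (B *v w))"
    by (rule mult_right_mono)
  then show ?thesis
    using r(3)[of w] by simp
qed

lemma transpose_sym_block: "transpose (sym_block B) = sym_block B"
  by (auto simp: vec_eq_iff transpose_def sym_block_def split: sum.splits)

text \<open>
  On a vector with unit blocks \<open>u\<close> and \<open>v\<close> the squared block norms add up to 2, and the Rayleigh
  bound becomes \<open>u \<bullet> (- (a + l *\<^sub>R \<xi>) *v v) \<le> - l\<close>. Duality then carries it from rank-one matrices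
  to all \<open>x\<close>.
\<close>
lemma nuclear_norm_bound_of_rayleigh_bound:
  fixes a \<xi> x :: "real ^ 'n ^ 'm"
  assumes ray: "\<And>w. l * (w \<bullet> ((mat 1 - sym_block \<xi>) *v w)) \<le> w \<bullet> (sym_block a *v w)"
  shows "l * (nuclear_norm x - \<xi> \<bullet> x) \<le> a \<bullet> x"
proof -
  have "- (a + l *\<^sub>R \<xi>) \<bullet> x \<le> - l * nuclear_norm x"
  proof (rule inner_le_nuclear_norm)
    fix u :: "real ^ 'm" and v :: "real ^ 'n"
    assume uv: "norm u = 1" "norm v = 1"
    obtain w :: "real ^ ('m + 'n)" where w: "upper_part w = u" "lower_part w = v"
      by (rule obtain_parts)
    have lin: "u \<bullet> (- (a + l *\<^sub>R \<xi>) *v v) = - (u \<bullet> (a *v v)) - l * (u \<bullet> (\<xi> *v v))"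
      by (simp add: inner_add_left inner_diff_left flip: inner_outer_prod)
    show "u \<bullet> (- (a + l *\<^sub>R \<xi>) *v v) \<le> - l"
      using ray[of w]
      unfolding lin quadratic_form_mat_1_minus_sym_block inner_sym_block w uv
      by (simp add: algebra_simps)
  qed
  then show ?thesis
    by (simp add: inner_add_left algebra_simps)
qed

theorem theorem2:
  fixes P2 :: "real ^ 'n ^ 'm \<Rightarrow> real"
    and \<mu> \<sigma> l :: real
    and y \<xi> a :: "real ^ 'n ^ 'm"
    and z :: "real ^ ('m + 'n)"
  assumes "is_norm P2"
    and "0 \<le> \<mu>" and "\<mu> < 1"
    and "\<And>x. P2 x \<le> \<mu> * nuclear_norm x"
    and "\<sigma> > 0"
    and "nuclear_norm y - P2 y \<le> \<sigma>"
    and "\<xi> \<in> subdifferential P2 y"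
    and "a \<noteq> 0"
    and "smallest_generalized_eigenvalue (sym_block a) (mat 1 - sym_block \<xi>) l"
    and "generalized_eigenvector (sym_block a) (mat 1 - sym_block \<xi>) l z"
    and "z \<bullet> ((mat 1 - sym_block \<xi>) *v z) = 1"
  shows "is_arg_min (\<lambda>x. a \<bullet> x) (\<lambda>x. nuclear_norm x - \<xi> \<bullet> x \<le> \<sigma>)
           ((2 * \<sigma>) *\<^sub>R outer_prod (upper_part z) (lower_part z))"
proof -
  let ?B = "mat 1 - sym_block \<xi>"
  let ?u = "upper_part z" and ?v = "lower_part z"
  have "u \<bullet> (\<xi> *v v) \<le> \<mu> * (norm u * norm v)" for u v
  proof -
    have "u \<bullet> (\<xi> *v v) \<le> P2 (outer_prod u v)"
      using subgradient_inner_le_norm[OF assms(1,7)] by (metis inner_outer_prod)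
    also have "\<dots> \<le> \<mu> * nuclear_norm (outer_prod u v)"
      by (rule assms(4))
    also have "\<dots> \<le> \<mu> * (norm u * norm v)"
      using nuclear_norm_outer_prod_le assms(2) by (rule mult_left_mono)
    finally show ?thesis .
  qed
  then have pos: "0 < w \<bullet> (?B *v w)" if "w \<noteq> 0" for w
    using positive_definite_mat_1_minus_sym_block assms(3) that by blast
  have "transpose ?B = ?B"
    using transpose_sym_block[of \<xi>] by (simp add: vec_eq_iff transpose_def mat_def)
  then have ray: "l * (w \<bullet> (?B *v w)) \<le> w \<bullet> (sym_block a *v w)" for w
    using smallest_generalized_eigenvalue_rayleigh[OF assms(9) transpose_sym_block] pos by blast
  have "l \<le> 0"
  proof -
    obtain w :: "real ^ ('m + 'n)" where w: "upper_part w = 1" "lower_part w = 0"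
      by (rule obtain_parts)
    have "w \<noteq> 0"
      using w(1) by (auto simp: upper_part_def vec_eq_iff intro!: exI[of _ "Inl undefined"])
    moreover have "l * (w \<bullet> (?B *v w)) \<le> 0"
      using ray[of w] by (simp add: inner_sym_block w)
    ultimately show ?thesis
      using pos[of w] by (simp add: mult_le_0_iff)
  qed
  let ?x = "(2 * \<sigma>) *\<^sub>R outer_prod ?u ?v"
  have normz: "(norm ?u)\<^sup>2 + (norm ?v)\<^sup>2 - 2 * (?u \<bullet> (\<xi> *v ?v)) = 1"
    using assms(11) by (simp add: quadratic_form_mat_1_minus_sym_block)
  have "?x = outer_prod ((2 * \<sigma>) *\<^sub>R ?u) ?v"
    by (simp add: vec_eq_iff)
  then have "nuclear_norm ?x \<le> 2 * \<sigma> * (norm ?u * norm ?v)"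
    using nuclear_norm_outer_prod_le[of "(2 * \<sigma>) *\<^sub>R ?u" ?v] assms(5) by simp
  also have "\<dots> \<le> \<sigma> * ((norm ?u)\<^sup>2 + (norm ?v)\<^sup>2)"
    using mult_left_mono[OF sum_squares_bound[of "norm ?u" "norm ?v"], of \<sigma>] assms(5)
    by (simp add: mult_ac)
  also have "\<dots> = \<sigma> * (1 + 2 * (?u \<bullet> (\<xi> *v ?v)))"
    using normz by simp
  finally have feasible: "nuclear_norm ?x - \<xi> \<bullet> ?x \<le> \<sigma>"
    by (simp add: inner_outer_prod algebra_simps)
  have "z \<bullet> (sym_block a *v z) = l"
    using assms(10,11) by (simp add: generalized_eigenvector_def)
  then have objective: "a \<bullet> ?x = l * \<sigma>"
    by (simp add: inner_sym_block inner_outer_prod algebra_simps)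
  have "a \<bullet> ?x \<le> a \<bullet> x" if "nuclear_norm x - \<xi> \<bullet> x \<le> \<sigma>" for x
    using mult_left_mono_neg[OF that \<open>l \<le> 0\<close>] nuclear_norm_bound_of_rayleigh_bound[OF ray, of x]
    unfolding objective by linarith
  then show ?thesis
    using feasible by (fastforce simp: is_arg_min_def not_less)
qed

end
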